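(* For any integer $r\ge 1$, $\Delta_{r,1}\ne 0$.
   Context: The Bernoulli polynomials $B_n(x)$ are defined by $\frac{ze^{xz}}{e^z-1}=\sum_{n\ge 0}B_n(x)\frac{z^n}{n!}$. For integers $r,D\ge1$, $\Delta_{r,D}$ is the determinant of the $rD\times rD$ matrix whose rows are indexed by $n=0,1,\dots,rD-1$ (in this order), and whose $(mD+v)$-th column ($0\le m\le r-1$, $1\le v\le D$) has in row $n$ the entry $D^{n+m}\,\frac{B_{n+m+1}(v/D)}{n+m+1}$. In particular $\Delta_{r,1}$ is the determinant of the $r\times r$ matrix with entry $\frac{B_{n+m+1}(1)}{n+m+1}$ in row $n$ and column $m$, $0\le n,m\le r-1$. *)

theory Defs
  imports
    "HOL-Computational_Algebra.Formal_Power_Series"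
    "Jordan_Normal_Form.Determinant"
begin

text \<open>The value $B_n(x)$ of the Bernoulli polynomial, read off from the generating function
  $z e^{xz} / (e^z - 1)$ in the formal variable $z$. The divisor has zero constant term, but
  division of power series cancels the common factor $z$ (cf.\ the lemma below).\<close>

definition bernoulli_poly :: "nat \<Rightarrow> real \<Rightarrow> real" where
  "bernoulli_poly n x = fact n * fps_nth (fps_X * fps_exp x / (fps_exp 1 - 1)) n"

lemma bernoulli_poly_generating_function:
  "Abs_fps (\<lambda>n. bernoulli_poly n x / fact n) = fps_X * fps_exp x / (fps_exp 1 - 1)"
  "Abs_fps (\<lambda>n. bernoulli_poly n x / fact n) * (fps_exp 1 - 1) = fps_X * fps_exp x"
proof -
  show eq: "Abs_fps (\<lambda>n. bernoulli_poly n x / fact n) = fps_X * fps_exp x / (fps_exp 1 - 1)"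
    by (rule fps_ext) (simp add: bernoulli_poly_def)
  have "subdegree (fps_exp 1 - 1 :: real fps) = 1"
    by (rule subdegreeI) auto
  then have "(fps_exp 1 - 1 :: real fps) dvd fps_X * fps_exp x"
    by (subst fps_dvd_iff) (auto simp: fps_eq_iff)
  then show "Abs_fps (\<lambda>n. bernoulli_poly n x / fact n) * (fps_exp 1 - 1) = fps_X * fps_exp x"
    by (simp add: eq)
qed

text \<open>Matrices are indexed from 0, so the $(mD+v)$-th column, $1 \le v \le D$, has index
  $j = mD + v - 1$; hence $m = j$ \<open>div\<close> $D$ and $v = j$ \<open>mod\<close> $D + 1$.\<close>

definition Delta_mat :: "nat \<Rightarrow> nat \<Rightarrow> real mat" where
  "Delta_mat r D = mat (r * D) (r * D) (\<lambda>(n, j).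
     let m = j div D; v = j mod D + 1
     in real D ^ (n + m) * (bernoulli_poly (n + m + 1) (real v / real D) / real (n + m + 1)))"

definition Delta :: "nat \<Rightarrow> nat \<Rightarrow> real" where
  "Delta r D = det (Delta_mat r D)"

lemma Delta_mat_1:
  "Delta_mat r 1 = mat r r (\<lambda>(n, m). bernoulli_poly (n + m + 1) 1 / real (n + m + 1))"
  by (rule eq_matI) (auto simp: Delta_mat_def Let_def)

end

theory Submission
  imports
    Defs
    "HOL-Analysis.Gamma_Function"
    "HOL-Analysis.FPS_Convergence"
begin

text \<open>The matrix is the Hankel matrix of $c_k = B_{k+1}(1)/(k+1)$. Here $c_0 = 1/2$, $c_k = 0$ for
  even $k > 0$, and by Euler's formula $c_k = 2 (-1)^{(k-1)/2} M_k$ for odd $k$, where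
  $M_k = \sum_{n \ge 1} k! / (2 \pi n)^{k+1}$. The Hankel form $\sum y_N y_M M_{N+M+1}$ is positive
  definite, since $\sum y_N y_M (N+M+1)!$ is a positive combination of squares of linear forms (in
  closed form, by Vandermonde's identity). A kernel vector of the matrix therefore vanishes: because of
  the checkerboard pattern of zeros, the rows of one parity determine its entries of the other parity up
  to the interference of $c_0$, and on each parity class the signs $(-1)^{(k-1)/2}$ are absorbed
  into the vector. Euler's formula is obtained by comparing the logarithmic derivative of the product
  for $\sinh(z/2)$ with the generating function of the Bernoulli polynomials.\<close>

section \<open>Positive definiteness of the factorial Hankel form\<close>

text \<open>This is the LDL^T factorization of the Hankel matrix of (N+M+1)!, the moments of t
  e^(-t) on the half-line. Up to sign, \<open>fact N * (Suc N choose Suc k)\<close> is the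
  coefficient of t^N at the Laguerre polynomial L_k^(1), whose squared norm is k+1. Any
  \<open>K > N\<close> is allowed so that one range serves all rows.\<close>

lemma fact_add_Suc_eq_sum:
  assumes "N < K"
  shows "(\<Sum>k<K. (k + 1) * (fact N * (Suc N choose Suc k)) * (fact M * (Suc M choose Suc k)))
    = (fact (N + M + 1) :: nat)"
proof -
  have "(\<Sum>k<K. (k + 1) * (fact N * (Suc N choose Suc k)) * (fact M * (Suc M choose Suc k)))
      = (\<Sum>k\<le>N. (k + 1) * (fact N * (Suc N choose Suc k)) * (fact M * (Suc M choose Suc k)))"
    using assms by (intro sum.mono_neutral_right) auto
  also have "\<dots> = (\<Sum>k\<le>N. fact N * (fact M * Suc M) * ((M choose k) * (Suc N choose (N - k))))"
  proof (intro sum.cong refl)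
    fix k assume "k \<in> {..N}"
    then have "Suc N choose Suc k = Suc N choose (N - k)"
      by (subst binomial_symmetric) auto
    moreover have "(k + 1) * (Suc M choose Suc k) = Suc M * (M choose k)"
      using Suc_times_binomial_eq[of M k] by (simp add: mult.commute)
    ultimately show "(k + 1) * (fact N * (Suc N choose Suc k)) * (fact M * (Suc M choose Suc k))
        = fact N * (fact M * Suc M) * ((M choose k) * (Suc N choose (N - k)))"
      by (metis (no_types, opaque_lifting) mult.assoc mult.commute)
  qed
  also have "\<dots> = fact N * fact (Suc M) * ((M + Suc N) choose N)"
    by (simp add: vandermonde mult.commute flip: sum_distrib_left)
  also have "\<dots> = fact (N + M + 1)"
    using binomial_fact_lemma[of N "M + Suc N"] by (simp add: ac_simps)
  finally show ?thesis .
qed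

lemma fact_quadratic_form:
  fixes y :: "nat \<Rightarrow> real"
  shows "(\<Sum>N<K. \<Sum>M<K. y N * y M * fact (N + M + 1))
    = (\<Sum>k<K. real (k + 1) * (\<Sum>N<K. y N * (fact N * (Suc N choose Suc k)))\<^sup>2)"
proof -
  let ?c = "\<lambda>k N. fact N * real (Suc N choose Suc k)"
  have "(\<Sum>N<K. \<Sum>M<K. y N * y M * fact (N + M + 1))
      = (\<Sum>N<K. \<Sum>M<K. \<Sum>k<K. real (k + 1) * ((y N * ?c k N) * (y M * ?c k M)))"
  proof (intro sum.cong refl)
    fix N M assume "N \<in> {..<K}"
    then have "N < K" by simp
    have "(fact (N + M + 1) :: real) = (\<Sum>k<K. real (k + 1) * ?c k N * ?c k M)"
      using fact_add_Suc_eq_sum[OF \<open>N < K\<close>, of M, THEN arg_cong[of _ _ real]]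
      by (simp only: of_nat_sum of_nat_mult of_nat_fact)
    then show "y N * y M * fact (N + M + 1)
        = (\<Sum>k<K. real (k + 1) * ((y N * ?c k N) * (y M * ?c k M)))"
      by (simp add: sum_distrib_left ac_simps del: binomial_Suc_Suc)
  qed
  also have "\<dots> = (\<Sum>N<K. \<Sum>k<K. \<Sum>M<K. real (k + 1) * ((y N * ?c k N) * (y M * ?c k M)))"
    by (intro sum.cong refl sum.swap)
  also have "\<dots> = (\<Sum>k<K. \<Sum>N<K. \<Sum>M<K. real (k + 1) * ((y N * ?c k N) * (y M * ?c k M)))"
    by (rule sum.swap)
  also have "\<dots> = (\<Sum>k<K. real (k + 1) * (\<Sum>N<K. y N * ?c k N)\<^sup>2)"
    unfolding power2_eq_square sum_product by (simp only: sum_distrib_left)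
  finally show ?thesis by simp
qed

lemma fact_quadratic_form_nonneg:
  fixes y :: "nat \<Rightarrow> real"
  shows "(\<Sum>N<K. \<Sum>M<K. y N * y M * fact (N + M + 1)) \<ge> 0"
  unfolding fact_quadratic_form by (intro sum_nonneg) auto

lemma fact_quadratic_form_eq_0D:
  fixes y :: "nat \<Rightarrow> real"
  assumes "(\<Sum>N<K. \<Sum>M<K. y N * y M * fact (N + M + 1)) = 0" and "N < K"
  shows "y N = 0"
proof -
  have *: "(\<Sum>N<K. y N * (fact N * (Suc N choose Suc k))) = 0" if "k < K" for k
  proof -
    have "real (k + 1) * (\<Sum>N<K. y N * (fact N * (Suc N choose Suc k)))\<^sup>2 = 0"
      using assms(1) that unfolding fact_quadratic_form
      by (subst (asm) sum_nonneg_eq_0_iff) (auto simp del: binomial_Suc_Suc)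
    then show ?thesis by (simp del: binomial_Suc_Suc)
  qed
  \<comment> \<open>the linear forms vanishing in \<open>*\<close> form an invertible triangular system\<close>
  show ?thesis
    using \<open>N < K\<close>
  \<comment> \<open>Back substitution from the top index: the binomial vanishes for
    \<open>i < N\<close>, the induction hypothesis covers \<open>i > N\<close>, and the diagonal
    coefficient is \<open>fact N\<close>.\<close>
  proof (induction "K - N" arbitrary: N rule: less_induct)
    case less
    have "0 = (\<Sum>i<K. y i * (fact i * (Suc i choose Suc N)))"
      using * less.prems by simp
    also have "\<dots> = (\<Sum>i\<in>{N}. y i * (fact i * (Suc i choose Suc N)))"
    proof (rule sum.mono_neutral_right)
      show "\<forall>i\<in>{..<K} - {N}. y i * (fact i * (Suc i choose Suc N)) = 0"
      proof
        fix i assume i: "i \<in> {..<K} - {N}"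
        show "y i * (fact i * (Suc i choose Suc N)) = 0"
        proof (cases "i < N")
          case False
          then have "y i = 0" using i by (intro less.hyps) auto
          then show ?thesis by simp
        qed (simp del: binomial_Suc_Suc)
      qed
    qed (use less.prems in auto)
    finally show "y N = 0" by simp
  qed
qed

section \<open>Hankel form of the zeta moments\<close>

text \<open>For $k = 0$ the series diverges, so that this value carries no meaning.\<close>

definition zeta_moment :: "nat \<Rightarrow> real" where
  "zeta_moment k = (\<Sum>n. fact k / (2 * pi * real (Suc n)) ^ (k + 1))"

lemma zeta_moment_sums:
  assumes "k \<ge> 1"
  shows "(\<lambda>n. fact k / (2 * pi * real (Suc n)) ^ (k + 1)) sums zeta_moment k"
proof -
  have "summable (\<lambda>n. inverse (real (Suc n)) ^ (k + 1))"
    using assms inverse_power_summable[of "k + 1", where 'a = real]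
    by (subst summable_Suc_iff) (simp add: power_inverse)
  then have "summable (\<lambda>n. fact k / (2 * pi) ^ (k + 1) * inverse (real (Suc n)) ^ (k + 1))"
    by (rule summable_mult)
  also have "(\<lambda>n. fact k / (2 * pi) ^ (k + 1) * inverse (real (Suc n)) ^ (k + 1))
      = (\<lambda>n. fact k / (2 * pi * real (Suc n)) ^ (k + 1))"
    by (rule ext) (simp only: power_mult_distrib divide_simps power_inverse, simp)
  finally show ?thesis
    unfolding zeta_moment_def by (rule summable_sums)
qed

text \<open>Since N+M+2 = (N+1)+(M+1), each term of the series is a factorial form in the rescaled
  vector \<open>w n\<close>, hence nonnegative. If the total is 0, every term is 0, and the term
  \<open>n = 0\<close> alone forces \<open>y\<close> to vanish.\<close>

lemma zeta_moment_quadratic_form_eq_0D: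
  assumes zero: "(\<Sum>N<K. \<Sum>M<K. y N * y M * zeta_moment (N + M + 1)) = 0" and "N < K"
  shows "y N = 0"
proof -
  define w where "w n N = y N / (2 * pi * real (Suc n)) ^ (N + 1)" for n N
  let ?Q = "\<lambda>n. \<Sum>N<K. \<Sum>M<K. w n N * w n M * fact (N + M + 1)"
  have "(\<lambda>n. \<Sum>N<K. \<Sum>M<K. y N * y M *
      (fact (N + M + 1) / (2 * pi * real (Suc n)) ^ (N + M + 1 + 1))) sums
    (\<Sum>N<K. \<Sum>M<K. y N * y M * zeta_moment (N + M + 1))"
    by (intro sums_sum sums_mult zeta_moment_sums) auto
  also have "(\<lambda>n. \<Sum>N<K. \<Sum>M<K. y N * y M *
      (fact (N + M + 1) / (2 * pi * real (Suc n)) ^ (N + M + 1 + 1))) = ?Q"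
    unfolding w_def by (intro ext sum.cong refl) (simp add: power_add power_mult_distrib)
  finally have Q: "?Q sums 0"
    unfolding zero .
  have "?Q 0 = 0"
    using Q fact_quadratic_form_nonneg suminf_eq_zero_iff[of ?Q] by (simp add: sums_iff)
  then have "w 0 N = 0"
    using \<open>N < K\<close> by (rule fact_quadratic_form_eq_0D)
  then show ?thesis
    by (simp add: w_def)
qed

section \<open>Kernel of the checkerboard Hankel matrix\<close>

text \<open>For N and M in the same parity class N+M+1 is odd, so only signed moments occur and
  \<open>c 0\<close> never enters. Twisting \<open>u\<close> by \<open>(-1) ^ (N div 2)\<close>
  turns the signed form into the definite one.\<close>

lemma parity_signed_moment_kernel:
  fixes c u :: "nat \<Rightarrow> real"
  assumes odd: "\<And>j. c (2 * j + 1) = 2 * (-1) ^ j * zeta_moment (2 * j + 1)"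
    and supp: "\<And>M. M < K \<Longrightarrow> even M \<noteq> p \<Longrightarrow> u M = 0"
    and rows: "\<And>N. N < K \<Longrightarrow> even N = p \<Longrightarrow> (\<Sum>M<K. c (N + M + 1) * u M) = 0"
    and "N < K"
  shows "u N = 0"
proof -
  \<comment> \<open>For odd N and M, (N+M) div 2 exceeds N div 2 + M div 2 by one; \<open>s\<close>
    compensates this sign.\<close>
  define s :: real where "s = (if p then 1 else -1)"
  define y where "y N = (-1) ^ (N div 2) * u N" for N
  have y: "y N * y M * zeta_moment (N + M + 1) = u N * (s / 2 * (c (N + M + 1) * u M))"
    if "N < K" "M < K" for N M
  proof (cases "even N = p \<and> even M = p")
    case True
    then have "N + M + 1 = 2 * ((N + M) div 2) + 1"
      by (cases p) auto
    then have "c (N + M + 1) = 2 * (-1) ^ ((N + M) div 2) * zeta_moment (N + M + 1)"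
      using odd by metis
    moreover have "(-1) ^ ((N + M) div 2) = s * (-1) ^ (N div 2) * (-1) ^ (M div 2)"
      using True by (cases p) (auto simp: s_def power_add elim!: evenE oddE)
    moreover have "s * s = 1"
      by (simp add: s_def)
    ultimately show ?thesis
      by (simp add: y_def)
  next
    case False
    then show ?thesis
      using supp that by (auto simp: y_def)
  qed
  have "(\<Sum>N<K. \<Sum>M<K. y N * y M * zeta_moment (N + M + 1))
      = (\<Sum>N<K. \<Sum>M<K. u N * (s / 2 * (c (N + M + 1) * u M)))"
    by (intro sum.cong refl y) auto
  also have "\<dots> = (\<Sum>N<K. u N * (s / 2 * (\<Sum>M<K. c (N + M + 1) * u M)))"
    by (simp only: sum_distrib_left)
  also have "\<dots> = 0"
    using supp rows by (intro sum.neutral) fastforce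
  finally have "y N = 0"
    using \<open>N < K\<close> by (rule zeta_moment_quadratic_form_eq_0D)
  then show ?thesis
    by (simp add: y_def)
qed

text \<open>Each parity class of entries reduces to the previous lemma through a shift by one: of
  the rows for the first class, of the vector for the second.\<close>

lemma signed_moment_hankel_kernel:
  fixes c v :: "nat \<Rightarrow> real"
  assumes c0: "c 0 \<noteq> 0"
    and even: "\<And>k. even k \<Longrightarrow> k > 0 \<Longrightarrow> c k = 0"
    and odd: "\<And>j. c (2 * j + 1) = 2 * (-1) ^ j * zeta_moment (2 * j + 1)"
    and rows: "\<And>n. n < r \<Longrightarrow> (\<Sum>m<r. c (n + m) * v m) = 0"
    and "m < r"
  shows "v m = 0"
proof -
  \<comment> \<open>With this parity the last index \<open>r - 1\<close> lies outside the class, so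
    row \<open>Suc N\<close> exists for every \<open>N\<close> in it. That row meets entries of the
    other class only at even positive indices of \<open>c\<close>, where \<open>c\<close>
    vanishes.\<close>
  define p where "p = even r"
  have A: "v M = 0" if "M < r" "even M = p" for M
  proof -
    define u where "u M = (if even M = p then v M else 0)" for M
    have "u M = 0"
    proof (rule parity_signed_moment_kernel[where c = c and K = r and p = p])
      fix N assume N: "N < r" "even N = p"
      then have "Suc N < r"
        by (metis Suc_lessI even_Suc p_def)
      have "(\<Sum>M<r. c (N + M + 1) * u M) = (\<Sum>M<r. c (Suc N + M) * v M)"
        using N even by (intro sum.cong refl) (auto simp: u_def)
      then show "(\<Sum>M<r. c (N + M + 1) * u M) = 0"
        using rows[OF \<open>Suc N < r\<close>] by simp
    qed (use odd that in \<open>auto simp: u_def\<close>)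
    then show ?thesis
      using that by (simp add: u_def)
  qed
  obtain q where r: "r = Suc q"
    using \<open>m < r\<close> by (cases r) auto
  have rows': "c n * v 0 + (\<Sum>M<q. c (n + M + 1) * v (Suc M)) = 0" if "n < r" for n
    using rows[OF that] unfolding r sum.lessThan_Suc_shift by simp
  \<comment> \<open>For even \<open>r\<close>, index 0 is covered by \<open>A\<close>. For odd
    \<open>r\<close>, row 0 reduces to \<open>c 0 * v 0\<close>, since each other term has a
    vanishing \<open>c\<close> or an entry covered by \<open>A\<close>.\<close>
  have v0: "v 0 = 0"
  proof (cases p)
    case False
    have "c (0 + M + 1) * v (Suc M) = 0" if "M < q" for M
      using A[of "Suc M"] even[of "Suc M"] that False r by (cases "even M") auto
    then have "(\<Sum>M<q. c (0 + M + 1) * v (Suc M)) = 0"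
      by (intro sum.neutral) simp
    then show ?thesis
      using rows'[of 0] c0 r by simp
  qed (use A r in auto)
  \<comment> \<open>With \<open>v 0\<close> gone, the remaining entries, shifted down by one, have
    parity \<open>p\<close>, and the unshifted rows \<open>N < q\<close> are the required
    equations.\<close>
  have "v (Suc M) = 0" if "M < q" for M
  proof (rule parity_signed_moment_kernel[where c = c and K = q and p = p and u = "\<lambda>M. v (Suc M)"])
    show "v (Suc M) = 0" if "M < q" "even M \<noteq> p" for M
      using that A r by auto
    show "(\<Sum>M<q. c (N + M + 1) * v (Suc M)) = 0" if "N < q" for N
      using rows'[of N] that r v0 by simp
  qed (use odd that in auto)
  then show ?thesis
    using v0 \<open>m < r\<close> r by (cases m) auto
qed

lemma det_signed_moment_hankel_nonzero:
  fixes c :: "nat \<Rightarrow> real"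
  assumes "c 0 \<noteq> 0"
    and "\<And>k. even k \<Longrightarrow> k > 0 \<Longrightarrow> c k = 0"
    and "\<And>j. c (2 * j + 1) = 2 * (-1) ^ j * zeta_moment (2 * j + 1)"
  shows "Determinant.det (Matrix.mat r r (\<lambda>(n, m). c (n + m))) \<noteq> 0"
proof
  let ?A = "Matrix.mat r r (\<lambda>(n, m). c (n + m))"
  assume "Determinant.det ?A = 0"
  then obtain v where v: "v \<in> carrier_vec r" "v \<noteq> 0\<^sub>v r" "?A *\<^sub>v v = 0\<^sub>v r"
    using det_0_iff_vec_prod_zero_field[of ?A r] by auto
  have "(\<Sum>m<r. c (n + m) * vec_index v m) = 0" if "n < r" for n
  proof -
    have "vec_index (?A *\<^sub>v v) n = 0"
      using v that by simp
    then show ?thesis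
      using v(1) that by (simp add: scalar_prod_def atLeast0LessThan)
  qed
  then have "vec_index v m = 0" if "m < r" for m
    using signed_moment_hankel_kernel[OF assms] that by blast
  then have "v = 0\<^sub>v r"
    using v(1) by auto
  then show False
    using v(2) by simp
qed

section \<open>Logarithm of the sinh product as a power series\<close>

text \<open>The expansion of $\ln (2 \sinh (z/2) / z)$.\<close>

definition log_sinh_fps :: "complex fps" where
  "log_sinh_fps = Abs_fps (\<lambda>k. if even k \<and> k > 0
     then of_real (2 * (-1) ^ (k div 2 - 1) * zeta_moment (k - 1) / fact k) else 0)"

text \<open>Expanding each \<open>Ln\<close> in powers of z^2 gives an absolutely convergent double
  series. Its row and column sums yield the two series, which therefore share one value
  \<open>S\<close>.\<close>

lemma log_sinh_fps_sums:
  fixes z :: complex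
  assumes "norm z < 1"
  shows "\<exists>S. (\<lambda>k. fps_nth log_sinh_fps k * z ^ k) sums S \<and>
    (\<lambda>n. Ln (1 + z\<^sup>2 / (2 * pi * real (Suc n))\<^sup>2)) sums S"
proof -
  define d where "d n = 2 * pi * real (Suc n)" for n
  define y :: "nat \<Rightarrow> complex" where "y n = z\<^sup>2 / of_real ((d n)\<^sup>2)" for n
  define a where "a n m = (-1) ^ m * y n ^ Suc m / of_nat (Suc m)" for n m
  define S where "S = infsum (\<lambda>(n, m). a n m) (UNIV \<times> UNIV)"
  have d: "d n \<ge> 2" for n
    using mult_mono[of 1 pi 1 "real (Suc n)"] pi_ge_two by (simp add: d_def)
  have y_le: "norm (y n) \<le> 1 / (d n)\<^sup>2" for n
    using assms by (simp add: y_def norm_divide norm_power power_le_one divide_right_mono)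
  have d4: "(d n)\<^sup>2 \<ge> 4" for n
    using power_mono[OF d[of n], of 2] by simp
  have y_half: "norm (y n) \<le> 1 / 2" for n
  proof -
    have "1 / (d n)\<^sup>2 \<le> 1 / 4"
      using d4 by (intro frac_le) auto
    then show ?thesis
      using y_le[of n] by linarith
  qed
  \<comment> \<open>The majorant is a product of a p-series in \<open>n\<close> and a geometric
    series in \<open>m\<close>, hence summable over pairs.\<close>
  have a_le: "norm (a n m) \<le> 1 / (d n)\<^sup>2 * (1 / 2) ^ m" for n m
  proof -
    have "norm (a n m) = norm (y n) * norm (y n) ^ m / real (Suc m)"
      by (simp add: a_def norm_divide norm_mult norm_power del: of_nat_Suc)
    also have "\<dots> \<le> norm (y n) * norm (y n) ^ m"
      using divide_left_mono[of 1 "real (Suc m)" "norm (y n) * norm (y n) ^ m"] by simp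
    also have "\<dots> \<le> 1 / (d n)\<^sup>2 * (1 / 2) ^ m"
      using y_le y_half by (intro mult_mono power_mono) auto
    finally show ?thesis .
  qed
  have "(\<lambda>(n, m). a n m) abs_summable_on UNIV \<times> UNIV"
  proof (rule abs_summable_on_comparison_test')
    show "(\<lambda>(n, m). 1 / (d n)\<^sup>2 * (1 / 2) ^ m) summable_on UNIV \<times> UNIV"
    proof (rule summable_on_SigmaI)
      fix n :: nat
      have "(\<lambda>m. 1 / (d n)\<^sup>2 * (1 / 2) ^ m) sums (1 / (d n)\<^sup>2 * (1 / (1 - 1 / 2)))"
        by (intro sums_mult geometric_sums) simp
      then show "((\<lambda>m. case (n, m) of (n, m) \<Rightarrow> 1 / (d n)\<^sup>2 * (1 / 2) ^ m) has_sum
          (1 / (d n)\<^sup>2 * 2)) UNIV"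
        by (intro sums_nonneg_imp_has_sum) auto
    next
      have "summable (\<lambda>n. 1 / (d n)\<^sup>2 * 2)"
        using zeta_moment_sums[of 1, THEN sums_summable] unfolding d_def
        by (intro summable_mult2) (simp add: numeral_2_eq_2)
      then show "(\<lambda>n. 1 / (d n)\<^sup>2 * 2) summable_on UNIV"
        by (intro norm_summable_imp_summable_on) simp
    qed auto
  qed (use a_le in auto)
  then have summ: "(\<lambda>(n, m). a n m) summable_on UNIV \<times> UNIV"
    by (rule abs_summable_summable)
  then have S: "((\<lambda>(n, m). a n m) has_sum S) (UNIV \<times> UNIV)"
    unfolding S_def by simp
  have "(\<lambda>(m, n). a n m) summable_on UNIV \<times> UNIV"
    using summ[THEN summable_on_swap[THEN iffD1]] by simp
  then have rowS: "((\<lambda>m. a n m) has_sum (\<Sum>\<^sub>\<infinity>m. a n m)) UNIV"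
    and colS: "((\<lambda>n. a n m) has_sum (\<Sum>\<^sub>\<infinity>n. a n m)) UNIV" for n m
    using summable_on_SigmaD1[OF summ, of n] summable_on_SigmaD1[of "\<lambda>m n. a n m" UNIV "\<lambda>_. UNIV" m]
    by simp_all
  have "(\<lambda>m. a n m) sums Ln (1 + y n)" for n
  proof -
    have "norm (y n) < 1"
      using y_half[of n] by linarith
    then have "(\<lambda>m. (-1) ^ Suc m / of_nat m * y n ^ m) sums Ln (1 + y n)"
      by (rule Ln_series)
    then show ?thesis
      using sums_Suc_iff[of "\<lambda>m. (-1) ^ Suc m / of_nat m * y n ^ m" "Ln (1 + y n)"]
      by (simp add: a_def[abs_def] del: of_nat_Suc)
  qed
  \<comment> \<open>Absolute convergence provides an unconditional sum and \<open>Ln_series\<close>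
    its value; uniqueness of limits identifies them. The columns are treated alike below.\<close>
  then have "((\<lambda>m. a n m) has_sum Ln (1 + y n)) UNIV" for n
    using has_sum_imp_sums[OF rowS] rowS sums_unique2 by metis
  then have Ln_S: "((\<lambda>n. Ln (1 + y n)) has_sum S) UNIV"
    using has_sum_SigmaD[OF S, of "\<lambda>n. Ln (1 + y n)"] by simp
  \<comment> \<open>The factor 2 in \<open>log_sinh_fps\<close> stems from (2m+2)! = 2 (m+1)
    (2m+1)!, where 1/(m+1) is the coefficient in the logarithm series.\<close>
  have "(\<lambda>n. a n m) sums (fps_nth log_sinh_fps (2 * m + 2) * z ^ (2 * m + 2))" for m
  proof -
    have "(\<lambda>n. complex_of_real (fact (2 * m + 1) / d n ^ (2 * m + 2))) sums
        of_real (zeta_moment (2 * m + 1))"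
      using zeta_moment_sums[of "2 * m + 1"] by (subst sums_of_real_iff) (simp add: d_def)
    then have "(\<lambda>n. ((-1) ^ m * z ^ (2 * m + 2) / (of_nat (Suc m) * fact (2 * m + 1))) *
          of_real (fact (2 * m + 1) / d n ^ (2 * m + 2))) sums
        (((-1) ^ m * z ^ (2 * m + 2) / (of_nat (Suc m) * fact (2 * m + 1))) *
          of_real (zeta_moment (2 * m + 1)))"
      by (rule sums_mult)
    moreover have "((-1) ^ m * z ^ (2 * m + 2) / (of_nat (Suc m) * fact (2 * m + 1))) *
          of_real (fact (2 * m + 1) / d n ^ (2 * m + 2)) = a n m" for n
    proof -
      have "y n ^ Suc m = z ^ (2 * m + 2) / of_real (d n) ^ (2 * m + 2)"
        by (simp only: y_def power_divide of_real_power flip: power_mult) simp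
      then show ?thesis
        by (simp add: a_def del: of_nat_Suc fact_Suc power_Suc)
    qed
    moreover have "((-1) ^ m * z ^ (2 * m + 2) / (of_nat (Suc m) * fact (2 * m + 1))) *
          of_real (zeta_moment (2 * m + 1)) = fps_nth log_sinh_fps (2 * m + 2) * z ^ (2 * m + 2)"
    proof -
      have "(fact (2 * m + 2) :: complex) = 2 * (of_nat (Suc m) * fact (2 * m + 1))"
        using fact_Suc[of "2 * m + 1", where 'a = complex] by (simp add: algebra_simps)
      then show ?thesis
        by (simp add: log_sinh_fps_def del: of_nat_Suc fact_Suc power_Suc)
    qed
    ultimately show ?thesis
      by simp
  qed
  then have "((\<lambda>n. a n m) has_sum (fps_nth log_sinh_fps (2 * m + 2) * z ^ (2 * m + 2))) UNIV" for m
    using has_sum_imp_sums[OF colS] colS sums_unique2 by metis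
  then have "((\<lambda>m. fps_nth log_sinh_fps (2 * m + 2) * z ^ (2 * m + 2)) has_sum S) UNIV"
    using has_sum_SigmaD[OF S[THEN has_sum_swap[THEN iffD1]],
        of "\<lambda>m. fps_nth log_sinh_fps (2 * m + 2) * z ^ (2 * m + 2)"] by simp
  then have "(\<lambda>m. fps_nth log_sinh_fps (2 * m + 2) * z ^ (2 * m + 2)) sums S"
    by (rule has_sum_imp_sums)
  moreover have "fps_nth log_sinh_fps k * z ^ k = 0" if "k \<notin> range (\<lambda>m. 2 * m + 2)" for k
  proof -
    have "k \<noteq> 2 * (k div 2 - 1) + 2"
      using that by blast
    then have "\<not> (even k \<and> k > 0)"
      by presburger
    then show ?thesis
      by (auto simp: log_sinh_fps_def)
  qed
  ultimately have "(\<lambda>k. fps_nth log_sinh_fps k * z ^ k) sums S"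
    using sums_mono_reindex[of "\<lambda>m. 2 * m + 2" "\<lambda>k. fps_nth log_sinh_fps k * z ^ k" S]
    by (simp add: strict_mono_def)
  moreover have "(\<lambda>n. Ln (1 + z\<^sup>2 / (2 * pi * real (Suc n))\<^sup>2)) sums S"
    using has_sum_imp_sums[OF Ln_S] unfolding y_def d_def .
  ultimately show ?thesis
    by blast
qed

section \<open>From the sinh product to a differential equation\<close>

lemma log_sinh_fps_conv_radius: "fps_conv_radius log_sinh_fps \<ge> ereal (1 / 2)"
proof -
  have "summable (\<lambda>k. fps_nth log_sinh_fps k * (1 / 2) ^ k)"
    using log_sinh_fps_sums[of "1 / 2"] by (auto simp: sums_iff)
  from conv_radius_geI[OF this] show ?thesis
    by (simp add: fps_conv_radius_def)
qed

text \<open>Euler's sine product at w = iz/(2 pi): here w^2 = -z^2/(2 pi)^2, and 2 sinh (z/2) = -2i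
  sin (iz/2).\<close>

lemma sinh_product:
  fixes z :: complex
  shows "(\<lambda>n. z * (\<Prod>k<n. 1 + z\<^sup>2 / (2 * pi * real (Suc k))\<^sup>2)) \<longlonglongrightarrow> exp (z / 2) - exp (- (z / 2))"
proof -
  define w where "w = \<i> * z / (2 * pi)"
  have pw: "of_real pi * w = \<i> * (z / 2)"
    by (simp add: w_def)
  have "(\<lambda>n. - 2 * \<i> * (of_real pi * w * (\<Prod>k=1..n. 1 - w\<^sup>2 / of_nat k ^ 2)))
      \<longlonglongrightarrow> - 2 * \<i> * sin (of_real pi * w)"
    by (intro tendsto_intros sin_product_formula_complex)
  also have "- 2 * \<i> * sin (of_real pi * w) = exp (z / 2) - exp (- (z / 2))"
    unfolding pw by (simp add: sin_exp_eq field_simps)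
  also have "(\<lambda>n. - 2 * \<i> * (of_real pi * w * (\<Prod>k=1..n. 1 - w\<^sup>2 / of_nat k ^ 2)))
      = (\<lambda>n. z * (\<Prod>k<n. 1 + z\<^sup>2 / (2 * pi * real (Suc k))\<^sup>2))"
  proof
    fix n
    have "(\<Prod>k=1..n. 1 - w\<^sup>2 / of_nat k ^ 2) = (\<Prod>k<n. 1 - w\<^sup>2 / of_nat (Suc k) ^ 2)"
      by (rule prod.reindex_bij_witness[of _ Suc "\<lambda>k. k - 1"]) auto
    also have "\<dots> = (\<Prod>k<n. 1 + z\<^sup>2 / (2 * pi * real (Suc k))\<^sup>2)"
      by (intro prod.cong refl) (simp add: w_def power_mult_distrib power_divide del: of_nat_Suc)
    finally show "- 2 * \<i> * (of_real pi * w * (\<Prod>k=1..n. 1 - w\<^sup>2 / of_nat k ^ 2))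
        = z * (\<Prod>k<n. 1 + z\<^sup>2 / (2 * pi * real (Suc k))\<^sup>2)"
      unfolding pw by simp
  qed
  finally show ?thesis .
qed

text \<open>Exponentiating the partial sums of \<open>Ln\<close> recovers the partial products. No
  factor vanishes, because the zeros have modulus 2 pi (n+1) > 1.\<close>

lemma exp_log_sinh:
  fixes z :: complex
  assumes "norm z < 1"
  shows "z * exp (eval_fps log_sinh_fps z) = exp (z / 2) - exp (- (z / 2))"
proof -
  let ?f = "\<lambda>n. 1 + z\<^sup>2 / (2 * pi * real (Suc n))\<^sup>2"
  obtain S where S: "(\<lambda>k. fps_nth log_sinh_fps k * z ^ k) sums S" "(\<lambda>n. Ln (?f n)) sums S"
    using log_sinh_fps_sums[OF assms] by blast
  have "?f n \<noteq> 0" for n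
  proof
    assume "?f n = 0"
    then have "z\<^sup>2 / (2 * pi * real (Suc n))\<^sup>2 = -1"
      by (metis add.commute eq_neg_iff_add_eq_0)
    then have "norm (z\<^sup>2 / (2 * pi * real (Suc n))\<^sup>2) = 1"
      by (metis norm_minus_cancel norm_one)
    then have "(norm z)\<^sup>2 = (2 * pi * real (Suc n))\<^sup>2"
      by (simp add: norm_divide norm_power norm_mult del: of_nat_Suc)
    then have "norm z = 2 * pi * real (Suc n)"
      by (subst (asm) power2_eq_iff_nonneg) auto
    moreover have "2 * pi * real (Suc n) \<ge> 1"
      using mult_mono[of 1 pi 1 "real (Suc n)"] pi_ge_two by simp
    ultimately show False
      using assms by simp
  qed
  then have "exp (\<Sum>k<n. Ln (?f k)) = (\<Prod>k<n. ?f k)" for n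
    by (subst exp_sum) (auto intro!: prod.cong exp_Ln)
  moreover have "(\<lambda>n. z * exp (\<Sum>k<n. Ln (?f k))) \<longlonglongrightarrow> z * exp S"
    using S(2) unfolding sums_def by (intro tendsto_intros)
  ultimately have "z * exp S = exp (z / 2) - exp (- (z / 2))"
    using sinh_product[of z] LIMSEQ_unique by fastforce
  then show ?thesis
    using S(1) by (simp add: eval_fps_def sums_iff)
qed

text \<open>With L = \<open>log_sinh_fps\<close>, the logarithmic derivative of z e^L e^(z/2) = e^z
  - 1 gives 1 + z (L' + 1/2) = z e^z / (e^z - 1). Clearing the denominator keeps both sides analytic
  at 0, so an identity of functions near 0 transfers to the power series.\<close>

lemma log_sinh_fps_ode:
  "fps_X * (fps_exp 1 - 1) * (fps_deriv log_sinh_fps + fps_const (1 / 2))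
    = fps_X * fps_exp 1 - fps_exp 1 + 1"
  (is "?L = ?R")
proof -
  let ?E = "eval_fps log_sinh_fps" and ?D = "eval_fps (fps_deriv log_sinh_fps)"
  have "fps_conv_radius log_sinh_fps > 0"
    using log_sinh_fps_conv_radius by (rule less_le_trans[rotated]) simp
  then have "?D has_fps_expansion fps_deriv log_sinh_fps"
    using fps_conv_radius_deriv[of log_sinh_fps]
    by (intro eval_fps_has_fps_expansion) (auto intro: less_le_trans)
  then have L: "(\<lambda>z. z * (exp z - 1) * (?D z + 1 / 2)) has_fps_expansion ?L"
    by (intro fps_expansion_intros)
  have R: "(\<lambda>z. z * exp z - exp z + 1) has_fps_expansion ?R"
    by (intro fps_expansion_intros)
  have "z * (exp z - 1) * (?D z + 1 / 2) = z * exp z - exp z + 1" if z: "norm z < 1 / 2" for z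
  proof -
    have "norm z < fps_conv_radius log_sinh_fps"
      using z log_sinh_fps_conv_radius by (auto intro: less_le_trans[of _ "ereal (1 / 2)"])
    then have D: "(?E has_field_derivative ?D z) (at z)"
      by (rule has_field_derivative_eval_fps)
    have eq: "w * exp (?E w) * exp (w / 2) = exp w - 1" if "w \<in> ball 0 (1 / 2)" for w
      using exp_log_sinh[of w] that
      by (simp add: left_diff_distrib flip: exp_add)
    have "((\<lambda>w. w * exp (?E w) * exp (w / 2)) has_field_derivative
        (exp (?E z) + z * (exp (?E z) * ?D z)) * exp (z / 2)
          + z * exp (?E z) * (exp (z / 2) / 2)) (at z)"
      by (auto intro!: derivative_eq_intros D simp: algebra_simps)
    moreover have "((\<lambda>w. w * exp (?E w) * exp (w / 2)) has_field_derivative exp z) (at z)"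
      by (rule has_field_derivative_transform_within_open[of "\<lambda>w. exp w - 1" _ _ "ball 0 (1 / 2)"])
        (use z eq in \<open>auto intro!: derivative_eq_intros\<close>)
    ultimately have exp_z: "(exp (?E z) + z * (exp (?E z) * ?D z)) * exp (z / 2)
          + z * exp (?E z) * (exp (z / 2) / 2) = exp z"
      by (rule DERIV_unique)
    \<comment> \<open>Multiplying by z instead of dividing by z e^L e^(z/2) keeps the point z = 0
      included.\<close>
    have "z * exp z = z * exp (?E z) * exp (z / 2) * (1 + z * (?D z + 1 / 2))"
      unfolding exp_z[symmetric] by (simp add: algebra_simps)
    also have "z * exp (?E z) * exp (z / 2) = exp z - 1"
      using eq z by simp
    finally show ?thesis
      by (simp add: field_simps)
  qed
  then have "eventually (\<lambda>z. z * (exp z - 1) * (?D z + 1 / 2) = z * exp z - exp z + 1) (nhds 0)"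
    by (intro eventually_nhds_in_open[THEN eventually_mono, of "ball 0 (1 / 2)"]) auto
  moreover have "eventually (\<lambda>z. eval_fps ?L z = z * (exp z - 1) * (?D z + 1 / 2)) (nhds 0)"
    and "eventually (\<lambda>z. eval_fps ?R z = z * exp z - exp z + 1) (nhds 0)"
    using L R by (simp_all add: has_fps_expansion_def)
  ultimately have "eventually (\<lambda>z. eval_fps ?L z = eval_fps ?R z) (nhds 0)"
    by eventually_elim simp
  then show ?thesis
    using L R by (intro eval_fps_eqD) (simp_all add: has_fps_expansion_def)
qed

section \<open>Values of the Bernoulli polynomials at 1\<close>

lemma bernoulli_poly_complex_fps:
  "Abs_fps (\<lambda>n. complex_of_real (bernoulli_poly n x / fact n)) * (fps_exp 1 - 1)
    = fps_X * fps_exp (of_real x)"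
proof (rule fps_ext)
  fix n
  have "fps_nth (Abs_fps (\<lambda>n. complex_of_real (bernoulli_poly n x / fact n)) * (fps_exp 1 - 1)) n
      = of_real (fps_nth (Abs_fps (\<lambda>n. bernoulli_poly n x / fact n) * (fps_exp 1 - 1)) n)"
    by (auto simp: fps_mult_nth intro!: sum.cong)
  also have "\<dots> = fps_nth (fps_X * fps_exp (of_real x)) n"
    unfolding bernoulli_poly_generating_function(2) by simp
  finally show "fps_nth (Abs_fps (\<lambda>n. complex_of_real (bernoulli_poly n x / fact n)) * (fps_exp 1 - 1)) n
      = fps_nth (fps_X * fps_exp (of_real x)) n" .
qed

text \<open>The differential equation says that the generating function at x = 1 is 1 + z (L' + 1/2)
  with L = \<open>log_sinh_fps\<close>; the coefficients of z^(k+1) are compared.\<close>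

lemma bernoulli_poly_one_div:
  "complex_of_real (bernoulli_poly (k + 1) 1 / real (k + 1))
    = fact k * fps_nth (fps_deriv log_sinh_fps + fps_const (1 / 2)) k"
proof -
  let ?F = "fps_deriv log_sinh_fps + fps_const (1 / 2)"
  let ?B = "Abs_fps (\<lambda>n. complex_of_real (bernoulli_poly n 1 / fact n))"
  have "fps_nth (fps_exp 1 - 1 :: complex fps) 1 \<noteq> 0"
    by simp
  then have nz: "fps_exp 1 - 1 \<noteq> (0 :: complex fps)"
    by (metis fps_zero_nth)
  have "(fps_X * ?F + 1) * (fps_exp 1 - 1) = ?B * (fps_exp 1 - 1)"
    using log_sinh_fps_ode bernoulli_poly_complex_fps[of 1] by (simp add: algebra_simps)
  then have "?B = fps_X * ?F + 1"
    using nz by simp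
  then have "fps_nth ?B (k + 1) = fps_nth (fps_X * ?F + 1) (k + 1)"
    by (rule arg_cong)
  then have "complex_of_real (bernoulli_poly (k + 1) 1 / fact (k + 1)) = fps_nth ?F k"
    by simp
  moreover have "bernoulli_poly (k + 1) 1 / real (k + 1) = fact k * (bernoulli_poly (k + 1) 1 / fact (k + 1))"
    by (simp del: of_nat_Suc)
  ultimately show ?thesis
    by (metis of_real_fact of_real_mult)
qed

lemma bernoulli_poly_one_one: "bernoulli_poly 1 1 = 1 / 2"
  using bernoulli_poly_one_div[of 0]
  by (simp add: log_sinh_fps_def flip: of_real_eq_iff[where 'a = complex])

text \<open>L' is an odd series, and \<open>k > 0\<close> avoids the constant 1/2.\<close>

lemma bernoulli_poly_one_odd:
  assumes "even k" "k > 0"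
  shows "bernoulli_poly (k + 1) 1 = 0"
  using bernoulli_poly_one_div[of k] assms
  by (auto simp: log_sinh_fps_def simp del: of_nat_Suc)

text \<open>Euler's formula for the zeta values at even integers, in terms of moments.\<close>

lemma bernoulli_poly_one_even:
  assumes "odd k"
  shows "bernoulli_poly (k + 1) 1 / real (k + 1) = 2 * (-1) ^ (k div 2) * zeta_moment k"
proof -
  have "fps_nth (fps_deriv log_sinh_fps + fps_const (1 / 2)) k = of_nat (Suc k) * fps_nth log_sinh_fps (Suc k)"
    using assms by (auto elim: oddE)
  also have "fps_nth log_sinh_fps (Suc k) = of_real (2 * (-1) ^ (k div 2) * zeta_moment k / fact (Suc k))"
    using assms by (auto simp: log_sinh_fps_def elim!: oddE)
  also have "of_nat (Suc k) * \<dots> = complex_of_real (2 * (-1) ^ (k div 2) * zeta_moment k / fact k)"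
    by (simp del: of_nat_Suc)
  finally have "complex_of_real (bernoulli_poly (k + 1) 1 / real (k + 1))
      = of_real (2 * (-1) ^ (k div 2) * zeta_moment k)"
    unfolding bernoulli_poly_one_div by simp
  then show ?thesis
    unfolding of_real_eq_iff .
qed

theorem theorem3p4:
  fixes r :: nat
  assumes "r \<ge> 1"
  shows "Delta r 1 \<noteq> 0"
proof -
  let ?c = "\<lambda>k. bernoulli_poly (k + 1) 1 / real (k + 1)"
  have "Determinant.det (Matrix.mat r r (\<lambda>(n, m). ?c (n + m))) \<noteq> 0"
  proof (rule det_signed_moment_hankel_nonzero)
    show "?c 0 \<noteq> 0"
      using bernoulli_poly_one_one by simp
    show "?c k = 0" if "even k" "k > 0" for k
      using bernoulli_poly_one_odd[OF that] by simp
    show "?c (2 * j + 1) = 2 * (-1) ^ j * zeta_moment (2 * j + 1)" for j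
      using bernoulli_poly_one_even[of "2 * j + 1"] by simp
  qed
  then show ?thesis
    unfolding Delta_def Delta_mat_1 .
qed

end
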